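(* Consider the unweighted stochastic probing problem on a finite universe $V$ with probabilities $\{p_e\}_{e\in V}$, inner constraint $\mathcal{I}_{in}$ and outer constraint $\mathcal{I}_{out}$, where $\mathcal{I}_{in}$ is a $k_{in}$-system and $\mathcal{I}_{out}$ is a $k_{out}$-system. Then the greedy algorithm achieves a $\frac{1}{k_{in}+k_{out}}$-approximation: the expected number of elements it chooses is at least $\frac{1}{k_{in}+k_{out}}$ times the maximum, over all (adaptive) policies, of the expected number of chosen elements. Moreover, this approximation ratio is tight.
   Context: Stochastic probing problem: $V$ is a finite universe; each $e\in V$ has a weight $w_e\ge 0$ and a probability $p_e\in[0,1]$, and is active independently of all other elements with probability $p_e$. $\mathcal{I}_{in},\mathcal{I}_{out}\subseteq 2^V$ are downward-closed families (inner and outer packing constraints). A policy probes elements one at a time, possibly adaptively; if $Q$ is the set probed so far and $S$ the set chosen so far (initially both empty), it may probe $e\in V\setminus Q$ only if $Q\cup\{e\}\in\mathcal{I}_{out}$ and $S\cup\{e\}\in\mathcal{I}_{in}$. After probing, $e$ is added to $Q$, and if $e$ is active it is irrevocably added to $S$. The goal is to maximize $\mathbb{E}[\sum_{e\in S}w_e]$. In the unweighted problem $w_e=1$ for all $e$. A $k$-system is a downward-closed $\mathcal{I}\subseteq 2^V$ such that for every $A\subseteq V$, every maximal independent subset of $A$ has size at least $\frac1k$ times the size of a maximum independent subset of $A$. The greedy algorithm considers the elements in non-increasing order of $p_e$ and probes each element $e$ whenever $Q\cup\{e\}\in\mathcal{I}_{out}$ and $S\cup\{e\}\in\mathcal{I}_{in}$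 for the current $Q,S$. *)

theory Defs
  imports "HOL-Probability.Probability" "HOL-Probability.Product_PMF"
begin

definition downward_closed :: "'a set set \<Rightarrow> bool" where
  "downward_closed \<I> \<longleftrightarrow> (\<forall>X\<in>\<I>. \<forall>Y. Y \<subseteq> X \<longrightarrow> Y \<in> \<I>)"

definition maximal_indep :: "'a set set \<Rightarrow> 'a set \<Rightarrow> 'a set \<Rightarrow> bool" where
  "maximal_indep \<I> A M \<longleftrightarrow>
     M \<in> \<I> \<and> M \<subseteq> A \<and> (\<forall>X\<in>\<I>. M \<subseteq> X \<and> X \<subseteq> A \<longrightarrow> X = M)"

definition maximum_indep :: "'a set set \<Rightarrow> 'a set \<Rightarrow> 'a set \<Rightarrow> bool" where
  "maximum_indep \<I> A N \<longleftrightarrow>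
     N \<in> \<I> \<and> N \<subseteq> A \<and> (\<forall>X\<in>\<I>. X \<subseteq> A \<longrightarrow> card X \<le> card N)"

definition k_system :: "real \<Rightarrow> 'a set \<Rightarrow> 'a set set \<Rightarrow> bool" where
  "k_system k V \<I> \<longleftrightarrow>
     \<I> \<subseteq> Pow V \<and> downward_closed \<I> \<and>
     (\<forall>A M N. A \<subseteq> V \<and> maximal_indep \<I> A M \<and> maximum_indep \<I> A N
        \<longrightarrow> real (card M) \<ge> 1 / k * real (card N))"

text \<open>
  An adaptive policy is a decision tree: in \<open>Probe e T F\<close> the element \<open>e\<close> is probed, and the
  policy continues with \<open>T\<close> if \<open>e\<close> is active and with \<open>F\<close> otherwise. Since no element may be
  probed twice, the history of outcomes is exactly the path from the root.
\<close>

datatype 'a policy = Stop | Probe 'a "'a policy" "'a policy"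

text \<open>\<open>Q\<close> and \<open>S\<close> are the sets of elements probed and chosen before the tree is entered.\<close>

primrec feasible_from ::
  "'a set \<Rightarrow> 'a set set \<Rightarrow> 'a set set \<Rightarrow> 'a set \<Rightarrow> 'a set \<Rightarrow> 'a policy \<Rightarrow> bool" where
  "feasible_from V I_in I_out Q S Stop \<longleftrightarrow> True"
| "feasible_from V I_in I_out Q S (Probe e T F) \<longleftrightarrow>
     e \<in> V - Q \<and> insert e Q \<in> I_out \<and> insert e S \<in> I_in \<and>
     feasible_from V I_in I_out (insert e Q) (insert e S) T \<and>
     feasible_from V I_in I_out (insert e Q) S F"

definition policies :: "'a set \<Rightarrow> 'a set set \<Rightarrow> 'a set set \<Rightarrow> 'a policy set" where
  "policies V I_in I_out = {T. feasible_from V I_in I_out {} {} T}"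

primrec chosen :: "('a \<Rightarrow> bool) \<Rightarrow> 'a policy \<Rightarrow> 'a set" where
  "chosen \<omega> Stop = {}"
| "chosen \<omega> (Probe e T F) = (if \<omega> e then insert e (chosen \<omega> T) else chosen \<omega> F)"

text \<open>Elements are active independently; outside \<open>V\<close> the outcome is fixed to \<open>False\<close>.\<close>

definition activity :: "'a set \<Rightarrow> ('a \<Rightarrow> real) \<Rightarrow> ('a \<Rightarrow> bool) pmf" where
  "activity V p = Pi_pmf V False (\<lambda>e. bernoulli_pmf (p e))"

definition expected_chosen :: "'a set \<Rightarrow> ('a \<Rightarrow> real) \<Rightarrow> 'a policy \<Rightarrow> real" where
  "expected_chosen V p T =
     measure_pmf.expectation (activity V p) (\<lambda>\<omega>. real (card (chosen \<omega> T)))"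

text \<open>The maximum is over a nonempty finite set, see \<open>finite_policies\<close> below.\<close>

definition opt_value :: "'a set \<Rightarrow> ('a \<Rightarrow> real) \<Rightarrow> 'a set set \<Rightarrow> 'a set set \<Rightarrow> real" where
  "opt_value V p I_in I_out = Max (expected_chosen V p ` policies V I_in I_out)"

lemma finite_feasible_from:
  assumes "finite V"
  shows "finite {T. feasible_from V I_in I_out Q S T}"
proof (induction "card (V - Q)" arbitrary: Q S rule: less_induct)
  case less
  let ?F = "\<lambda>Q S. {T. feasible_from V I_in I_out Q S T}"
  have "?F Q S \<subseteq> insert Stop (\<Union>e\<in>V - Q. (\<lambda>(T, F). Probe e T F) `
          (?F (insert e Q) (insert e S) \<times> ?F (insert e Q) S))"
  proof
    fix T assume "T \<in> ?F Q S"
    then show "T \<in> insert Stop (\<Union>e\<in>V - Q. (\<lambda>(T, F). Probe e T F) `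
          (?F (insert e Q) (insert e S) \<times> ?F (insert e Q) S))"
      by (cases T) force+
  qed
  moreover have "finite (?F (insert e Q) S')" if "e \<in> V - Q" for e S'
  proof (rule less)
    show "card (V - insert e Q) < card (V - Q)"
      by (rule psubset_card_mono) (use that assms in auto)
  qed
  ultimately show ?case
    using assms by (elim finite_subset) auto
qed

lemma finite_policies: "finite V \<Longrightarrow> finite (policies V I_in I_out)"
  unfolding policies_def by (rule finite_feasible_from)

lemma policies_nonempty: "policies V I_in I_out \<noteq> {}"
  using feasible_from.simps(1) unfolding policies_def by blast

text \<open>
  The greedy algorithm, processing a list of elements from the state \<open>Q\<close>, \<open>S\<close>, written as a
  decision tree. Ties between equal probabilities may be broken in any way, so the order is a
  parameter.
\<close>

primrec greedy_from ::
  "'a set set \<Rightarrow> 'a set set \<Rightarrow> 'a list \<Rightarrow> 'a set \<Rightarrow> 'a set \<Rightarrow> 'a policy" where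
  "greedy_from I_in I_out [] Q S = Stop"
| "greedy_from I_in I_out (e # es) Q S =
     (if insert e Q \<in> I_out \<and> insert e S \<in> I_in
      then Probe e (greedy_from I_in I_out es (insert e Q) (insert e S))
                   (greedy_from I_in I_out es (insert e Q) S)
      else greedy_from I_in I_out es Q S)"

definition greedy :: "'a set set \<Rightarrow> 'a set set \<Rightarrow> 'a list \<Rightarrow> 'a policy" where
  "greedy I_in I_out es = greedy_from I_in I_out es {} {}"

definition greedy_order :: "'a set \<Rightarrow> ('a \<Rightarrow> real) \<Rightarrow> 'a list \<Rightarrow> bool" where
  "greedy_order V p es \<longleftrightarrow> distinct es \<and> set es = V \<and> sorted_wrt (\<lambda>e f. p e \<ge> p f) es"

definition probing_instance ::
  "real \<Rightarrow> real \<Rightarrow> 'a set \<Rightarrow> ('a \<Rightarrow> real) \<Rightarrow> 'a set set \<Rightarrow> 'a set set \<Rightarrow> bool" where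
  "probing_instance k_in k_out V p I_in I_out \<longleftrightarrow>
     finite V \<and> (\<forall>e\<in>V. 0 \<le> p e \<and> p e \<le> 1) \<and> k_system k_in V I_in \<and> k_system k_out V I_out"

end

theory Submission
  imports Defs
begin

text \<open>
  Fix a policy \<open>T\<close>, let \<open>y e\<close> be the probability that it probes \<open>e\<close> and let \<open>x e = p e * y e\<close>.
  Since \<open>T\<close> is feasible on every path, the \<open>y\<close>-mass of a set is at most its \<open>I_out\<close>-rank and its
  \<open>x\<close>-mass is at most its \<open>I_in\<close>-rank. On every path of greedy, with final sets \<open>Q\<close> and \<open>S\<close>, the
  set \<open>S\<close> is maximal in \<open>S\<close> together with the elements rejected by \<open>I_in\<close>, so these have \<open>x\<close>-mass
  at most \<open>k_in * card S\<close>. At any time \<open>Q\<close> is maximal in \<open>Q\<close> together with the elements rejected so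
  far by \<open>I_out\<close>; as elements arrive by non-increasing \<open>p\<close>, Abel summation bounds their \<open>x\<close>-mass
  by \<open>k_out * sum p Q\<close>. Both \<open>card S\<close> and \<open>sum p Q\<close> have the value of greedy as expectation.

  For tightness, let greedy first be offered a set \<open>G\<close> of \<open>n\<close> surely active elements, where \<open>G\<close>
  blocks about \<open>k_in * n\<close> elements through \<open>I_in\<close> and about \<open>k_out * n\<close> others through \<open>I_out\<close>,
  all of which are active with probability close to one and can be probed together.
\<close>

section \<open>Expectations over decision trees\<close>

text \<open>Expected total \<open>h\<close>-weight of the probed elements. As a recursion on the
  tree it turns the later probability arguments into inductions. On feasible trees
  \<open>h = p\<close> gives the expected number of chosen elements, and
  \<open>h = indicator {e}\<close> the probability that \<open>e\<close> is probed.\<close>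

primrec probed_weight :: "('a \<Rightarrow> real) \<Rightarrow> ('a \<Rightarrow> real) \<Rightarrow> 'a policy \<Rightarrow> real" where
  "probed_weight p h Stop = 0"
| "probed_weight p h (Probe e T F) =
     h e + p e * probed_weight p h T + (1 - p e) * probed_weight p h F"

lemma set_policy_feasible:
  assumes "feasible_from V I_in I_out Q S T"
  shows "set_policy T \<subseteq> V - Q"
  using assms
proof (induction T arbitrary: Q S)
  case (Probe e T F)
  then have "set_policy T \<subseteq> V - insert e Q" "set_policy F \<subseteq> V - insert e Q" "e \<in> V - Q"
    using Probe.IH(1)[of "insert e Q" "insert e S"] Probe.IH(2)[of "insert e Q" S] by auto
  then show ?case
    by auto
qed simp

lemma finite_set_policy: "finite (set_policy T)"
  by (induction T) auto

lemma chosen_subset: "chosen a T \<subseteq> set_policy T"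
  by (induction T) auto

lemma chosen_fun_upd: "e \<notin> set_policy T \<Longrightarrow> chosen (a(e := b)) T = chosen a T"
  by (induction T) auto

lemma integrable_card_chosen: "integrable (measure_pmf M) (\<lambda>a. real (card (chosen a T)))"
proof (rule measure_pmf.integrable_const_bound[where B = "card (set_policy T)"])
  show "AE a in measure_pmf M. norm (real (card (chosen a T))) \<le> real (card (set_policy T))"
    by (simp add: card_mono chosen_subset finite_set_policy)
qed simp

text \<open>Conditioning on the outcome of \<open>e\<close>: by independence the other coordinates
  keep their product law \<open>M\<close>.\<close>

lemma expectation_Pi_pmf_split:
  fixes g :: "('a \<Rightarrow> bool) \<Rightarrow> real"
  assumes "finite W" "e \<in> W" "0 \<le> q e" "q e \<le> 1"
  defines "M \<equiv> Pi_pmf (W - {e}) False (\<lambda>x. bernoulli_pmf (q x))"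
  shows "measure_pmf.expectation (Pi_pmf W False (\<lambda>x. bernoulli_pmf (q x))) g =
           q e * measure_pmf.expectation M (\<lambda>a. g (a(e := True))) +
           (1 - q e) * measure_pmf.expectation M (\<lambda>a. g (a(e := False)))"
proof -
  have "W = insert e (W - {e})"
    using \<open>e \<in> W\<close> by auto
  then have "Pi_pmf W False (\<lambda>x. bernoulli_pmf (q x)) =
      bernoulli_pmf (q e) \<bind> (\<lambda>b. map_pmf (\<lambda>a. a(e := b)) M)"
    using Pi_pmf_insert'[of "W - {e}" e False "\<lambda>x. bernoulli_pmf (q x)"] \<open>finite W\<close>
    by (simp add: M_def map_pmf_def)
  moreover have "finite (set_pmf M)"
    using \<open>finite W\<close> by (simp add: M_def set_Pi_pmf finite_PiE_dflt)
  ultimately have "measure_pmf.expectation (Pi_pmf W False (\<lambda>x. bernoulli_pmf (q x))) g =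
      (\<Sum>b\<in>UNIV. pmf (bernoulli_pmf (q e)) b *
        measure_pmf.expectation (map_pmf (\<lambda>f. f(e := b)) M) g)"
    by (simp only: real_scaleR_def) (subst pmf_expectation_bind[where A = UNIV]; simp)
  then show ?thesis
    using assms(3,4) by (simp only: UNIV_bool integral_map_pmf) simp
qed

text \<open>The index set is a general \<open>W\<close> because the induction splits off the root
  coordinate. A feasible tree never probes an element again, so the subtrees do not depend on the
  outcome at the root.\<close>

lemma expectation_card_chosen:
  assumes "feasible_from V I_in I_out Q S T" "finite W" "set_policy T \<subseteq> W"
    and "\<forall>e\<in>W. 0 \<le> p e \<and> p e \<le> 1"
  shows "measure_pmf.expectation (Pi_pmf W False (\<lambda>e. bernoulli_pmf (p e)))
           (\<lambda>a. real (card (chosen a T))) = probed_weight p p T"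
  using assms
proof (induction T arbitrary: Q S W)
  case Stop
  then show ?case by simp
next
  case (Probe e T F)
  let ?M = "Pi_pmf (W - {e}) False (\<lambda>e. bernoulli_pmf (p e))"
  have feas: "feasible_from V I_in I_out (insert e Q) (insert e S) T"
    "feasible_from V I_in I_out (insert e Q) S F"
    using Probe.prems(1) by auto
  have fresh: "e \<notin> set_policy T" "e \<notin> set_policy F"
    using feas[THEN set_policy_feasible] by auto
  have IH: "measure_pmf.expectation ?M (\<lambda>a. real (card (chosen a T))) = probed_weight p p T"
    "measure_pmf.expectation ?M (\<lambda>a. real (card (chosen a F))) = probed_weight p p F"
    by (rule Probe.IH(1)[OF feas(1)] Probe.IH(2)[OF feas(2)]; use Probe.prems fresh in auto)+
  have card_insert_chosen:
    "card (insert e (chosen a T)) = Suc (card (chosen a T))" for a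
    using fresh chosen_subset[of a T] finite_set_policy[of T] finite_subset
    by (intro card_insert_disjoint) blast+
  have "measure_pmf.expectation (Pi_pmf W False (\<lambda>e. bernoulli_pmf (p e)))
          (\<lambda>a. real (card (chosen a (Probe e T F)))) =
      p e * measure_pmf.expectation ?M (\<lambda>a. 1 + real (card (chosen a T))) +
      (1 - p e) * measure_pmf.expectation ?M (\<lambda>a. real (card (chosen a F)))"
    using Probe.prems fresh
    by (subst expectation_Pi_pmf_split[where e = e])
      (auto simp: chosen_fun_upd card_insert_chosen)
  also have "measure_pmf.expectation ?M (\<lambda>a. 1 + real (card (chosen a T))) =
      1 + probed_weight p p T"
    by (simp add: integrable_card_chosen IH)
  finally show ?case
    by (simp add: IH algebra_simps)
qed

lemma expected_chosen_eq:
  assumes "T \<in> policies V I_in I_out" "finite V" "\<forall>e\<in>V. 0 \<le> p e \<and> p e \<le> 1"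
  shows "expected_chosen V p T = probed_weight p p T"
  using assms set_policy_feasible[of V I_in I_out "{}" "{}" T]
  unfolding expected_chosen_def activity_def policies_def
  by (intro expectation_card_chosen) auto

lemma probed_weight_nonneg:
  assumes "\<forall>e\<in>set_policy T. 0 \<le> p e \<and> p e \<le> 1 \<and> 0 \<le> h e"
  shows "0 \<le> probed_weight p h T"
  using assms by (induction T) auto

text \<open>Linearity in \<open>h\<close>; the coefficient of \<open>h e\<close> is the probability
  that \<open>e\<close> is probed.\<close>

lemma probed_weight_sum:
  assumes "finite V" "set_policy T \<subseteq> V"
  shows "probed_weight p h T = (\<Sum>e\<in>V. h e * probed_weight p (indicator {e}) T)"
  using assms
proof (induction T)
  case Stop
  then show ?case by simp
next
  case (Probe f T F)
  have "(\<Sum>e\<in>V. h e * indicator {e} f) = h f"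
    using Probe.prems by (simp add: indicator_def if_distrib cong: if_cong)
  with Probe show ?case
    by (simp add: algebra_simps sum.distrib sum_subtractf sum_distrib_left)
qed

lemma greedy_feasible:
  assumes "distinct es" "set es \<subseteq> V - Q"
  shows "feasible_from V I_in I_out Q S (greedy_from I_in I_out es Q S)"
  using assms
proof (induction es arbitrary: Q S)
  case (Cons e es)
  then have "set es \<subseteq> V - Q" "set es \<subseteq> V - insert e Q"
    by auto
  with Cons show ?case
    by simp
qed simp

section \<open>The approximation guarantee\<close>

text \<open>The definition compares \<open>M\<close> only with a maximum independent subset of
  \<open>A\<close>. One exists because cardinalities are bounded by \<open>card V\<close>, and it is
  at least as large as \<open>X\<close>.\<close>

lemma k_system_card_le:
  assumes "k_system k V I" "k > 0" "finite V" "A \<subseteq> V" "maximal_indep I A M"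
    and "X \<in> I" "X \<subseteq> A"
  shows "real (card X) \<le> k * real (card M)"
proof -
  let ?P = "\<lambda>Y. Y \<in> I \<and> Y \<subseteq> A"
  have "card Y < Suc (card V)" if "?P Y" for Y
    using that \<open>A \<subseteq> V\<close> \<open>finite V\<close> by (auto simp: less_Suc_eq_le intro!: card_mono)
  then obtain N where "?P N" "\<forall>Y. ?P Y \<longrightarrow> card Y \<le> card N"
    using ex_has_greatest_nat[of ?P X card "Suc (card V)"] assms(6,7) by force
  then have "maximum_indep I A N" and "card X \<le> card N"
    using assms(6,7) by (auto simp: maximum_indep_def)
  then have "real (card M) \<ge> 1 / k * real (card N)"
    using assms unfolding k_system_def by blast
  then have "real (card N) \<le> k * real (card M)"
    using \<open>k > 0\<close> by (simp add: field_simps)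
  with \<open>card X \<le> card N\<close> show ?thesis
    by linarith
qed

text \<open>Cutting a competitor down to \<open>A\<close> gives an independent set between
  \<open>M\<close> and \<open>A\<close>, hence \<open>M\<close> itself. With
  \<open>maximal_indep_reject\<close> this maintains maximality while greedy accepts or rejects
  elements.\<close>

lemma maximal_indep_insert:
  assumes "downward_closed I" "maximal_indep I A M" "insert e M \<in> I"
  shows "maximal_indep I (insert e A) (insert e M)"
  unfolding maximal_indep_def
proof (intro conjI ballI impI)
  fix X assume X: "X \<in> I" "insert e M \<subseteq> X \<and> X \<subseteq> insert e A"
  have "X \<inter> A \<in> I"
    using X(1) assms(1) by (auto simp: downward_closed_def)
  moreover have "M \<subseteq> X \<inter> A"
    using X(2) assms(2) by (auto simp: maximal_indep_def)
  ultimately have "X \<inter> A = M"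
    using assms(2) by (auto simp: maximal_indep_def)
  then show "X = insert e M"
    using X by auto
qed (use assms in \<open>auto simp: maximal_indep_def\<close>)

text \<open>A competitor containing \<open>e\<close> would contain the dependent set
  \<open>insert e M\<close>.\<close>

lemma maximal_indep_reject:
  assumes "downward_closed I" "maximal_indep I A M" "insert e M \<notin> I"
  shows "maximal_indep I (insert e A) M"
  unfolding maximal_indep_def
proof (intro conjI ballI impI)
  fix X assume X: "X \<in> I" "M \<subseteq> X \<and> X \<subseteq> insert e A"
  then have "e \<notin> X"
    using assms(1,3) by (auto simp: downward_closed_def)
  then have "X \<subseteq> A"
    using X(2) by auto
  with X show "X = M"
    using assms(2) by (auto simp: maximal_indep_def)
qed (use assms in \<open>auto simp: maximal_indep_def\<close>)

section \<open>Rank bounds for arbitrary policies\<close>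

text \<open>On every path the probed set stays in \<open>I_out\<close> and meets \<open>A\<close> in
  at most \<open>r\<close> elements; the bound is the average over paths. The term
  \<open>card (Q \<inter> A)\<close> carries the count so far through the induction.\<close>

lemma probed_weight_outer_bound:
  assumes "feasible_from V I_in I_out Q S T" "Q \<in> I_out" "finite V" "Q \<subseteq> V"
    and "\<forall>e\<in>V. 0 \<le> p e \<and> p e \<le> 1"
    and "\<forall>X\<in>I_out. real (card (X \<inter> A)) \<le> r"
  shows "real (card (Q \<inter> A)) + probed_weight p (indicator A) T \<le> r"
  using assms
proof (induction T arbitrary: Q S)
  case Stop
  then show ?case by simp
next
  case (Probe e T F)
  have "finite Q"
    using Probe.prems finite_subset by blast
  then have card: "real (card (insert e Q \<inter> A)) = real (card (Q \<inter> A)) + indicator A e"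
    using Probe.prems by (auto simp: indicator_def)
  have "real (card (insert e Q \<inter> A)) + probed_weight p (indicator A) T \<le> r"
    by (rule Probe.IH(1)[of _ "insert e S"]) (use Probe.prems in auto)
  moreover have "real (card (insert e Q \<inter> A)) + probed_weight p (indicator A) F \<le> r"
    by (rule Probe.IH(2)[of _ S]) (use Probe.prems in auto)
  moreover have "0 \<le> p e" "p e \<le> 1"
    using Probe.prems by auto
  ultimately have "p e * (real (card (insert e Q \<inter> A)) + probed_weight p (indicator A) T) +
      (1 - p e) * (real (card (insert e Q \<inter> A)) + probed_weight p (indicator A) F) \<le> r"
    by (intro convex_bound_le) auto
  then show ?case
    by (simp add: card algebra_simps)
qed

text \<open>The same averaging for the chosen set, which gains \<open>e\<close> only in the active
  branch; hence the factor \<open>p e\<close>. The invariant \<open>S \<subseteq> Q\<close> ensures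
  that a newly probed element is not yet in \<open>S\<close>.\<close>

lemma probed_weight_inner_bound:
  assumes "feasible_from V I_in I_out Q S T" "S \<in> I_in" "finite V" "S \<subseteq> Q" "Q \<subseteq> V"
    and "\<forall>e\<in>V. 0 \<le> p e \<and> p e \<le> 1"
    and "\<forall>X\<in>I_in. real (card (X \<inter> A)) \<le> r"
  shows "real (card (S \<inter> A)) + probed_weight p (\<lambda>e. p e * indicator A e) T \<le> r"
  using assms
proof (induction T arbitrary: Q S)
  case Stop
  then show ?case by simp
next
  case (Probe e T F)
  let ?w = "probed_weight p (\<lambda>e. p e * indicator A e)"
  have "finite S" "e \<notin> S"
    using Probe.prems by (auto intro: finite_subset)
  then have card: "real (card (insert e S \<inter> A)) = real (card (S \<inter> A)) + indicator A e"
    by (auto simp: indicator_def)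
  have "real (card (insert e S \<inter> A)) + ?w T \<le> r"
    by (rule Probe.IH(1)[of "insert e Q"]) (use Probe.prems in auto)
  moreover have "real (card (S \<inter> A)) + ?w F \<le> r"
    by (rule Probe.IH(2)[of "insert e Q"]) (use Probe.prems in auto)
  moreover have "0 \<le> p e" "p e \<le> 1"
    using Probe.prems by auto
  ultimately have "p e * (real (card (insert e S \<inter> A)) + ?w T) +
      (1 - p e) * (real (card (S \<inter> A)) + ?w F) \<le> r"
    by (intro convex_bound_le) auto
  then show ?case
    by (simp add: card algebra_simps)
qed

text \<open>
  \<open>W\<close> consists of \<open>Q\<close> and the elements rejected by the outer constraint, \<open>Z\<close> of \<open>S\<close> and those
  rejected by the inner one. Shifting by a threshold \<open>t\<close> between the probabilities of processed
  and pending elements makes the weight of a newly processed element vanish.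
\<close>

lemma greedy_from_bound:
  fixes x y :: "'a \<Rightarrow> real"
  assumes "finite V" "k_in > 0" "k_out > 0"
    and "\<forall>e\<in>V. 0 \<le> p e \<and> p e \<le> 1" "\<forall>e\<in>V. 0 \<le> y e"
    and "downward_closed I_in" "downward_closed I_out"
    and outer: "\<And>A M. A \<subseteq> V \<Longrightarrow> maximal_indep I_out A M \<Longrightarrow> sum y A \<le> k_out * real (card M)"
    and inner: "\<And>A M. A \<subseteq> V \<Longrightarrow> maximal_indep I_in A M \<Longrightarrow>
      (\<Sum>e\<in>A. p e * y e) \<le> k_in * real (card M)"
    and "maximal_indep I_out W Q" "maximal_indep I_in Z S"
    and "distinct es" "sorted_wrt (\<lambda>e f. p e \<ge> p f) es"
    and "set es \<inter> (W \<union> Z) = {}" "V = W \<union> Z \<union> set es"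
    and "\<forall>e\<in>set es. p e \<le> t" "0 \<le> t"
    and "(\<Sum>e\<in>W. (p e - t) * y e) \<le> k_out * (\<Sum>e\<in>Q. p e - t)"
  defines "g \<equiv> \<lambda>es Q S. probed_weight p p (greedy_from I_in I_out es Q S)"
  shows "(\<Sum>e\<in>V. p e * y e) \<le> k_in * (real (card S) + g es Q S) + k_out * (sum p Q + g es Q S)"
  using assms(10-18)
proof (induction es arbitrary: W Q Z S t)
  case Nil
  have fin: "finite W" "finite Z" "finite Q"
    using \<open>finite V\<close> Nil by (auto simp: maximal_indep_def finite_subset)
  \<comment> \<open>Adding \<open>t\<close> times the rank bound for \<open>W\<close> removes the
    shift by \<open>t\<close>.\<close>
  have "t * sum y W \<le> t * (k_out * real (card Q))"
    using Nil outer[of W Q] by (intro mult_left_mono) auto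
  with Nil.prems(9) have "(\<Sum>e\<in>W. p e * y e) \<le> k_out * sum p Q"
    by (simp add: algebra_simps sum_subtractf sum_distrib_left)
  moreover have "(\<Sum>e\<in>Z. p e * y e) \<le> k_in * real (card S)"
    using Nil by (intro inner) auto
  \<comment> \<open>Now \<open>V = W \<union> Z\<close>; counting the overlap twice is harmless as
    all terms are nonnegative.\<close>
  moreover have "(\<Sum>e\<in>V. p e * y e) \<le> (\<Sum>e\<in>W. p e * y e) + (\<Sum>e\<in>Z. p e * y e)"
    using Nil fin assms(4,5) by (auto simp: sum_Un intro!: sum_nonneg)
  ultimately show ?case
    by (simp add: g_def)
next
  case (Cons e es)
  have fin: "finite W" "finite Z" "finite Q" "finite S"
    using \<open>finite V\<close> Cons.prems by (auto simp: maximal_indep_def finite_subset)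
  have e: "e \<notin> W" "e \<notin> Z" "e \<notin> Q" "e \<notin> S" "0 \<le> p e" "p e \<le> 1" "p e \<le> t"
    using Cons.prems assms(4) by (auto simp: maximal_indep_def)
  \<comment> \<open>One step of the Abel summation: the rank bound for \<open>W\<close>, scaled by
    \<open>t - p e\<close>, lowers the threshold from \<open>t\<close> to \<open>p e\<close>. The
    term of \<open>e\<close> then vanishes, so \<open>e\<close> can join \<open>W\<close>, with or
    without joining \<open>Q\<close>. The order keeps pending probabilities at most
    \<open>p e\<close>.\<close>
  have "(t - p e) * sum y W \<le> (t - p e) * (k_out * real (card Q))"
    using Cons.prems outer[of W Q] e by (intro mult_left_mono) auto
  with Cons.prems(9) have t: "(\<Sum>f\<in>W. (p f - p e) * y f) \<le> k_out * (\<Sum>f\<in>Q. p f - p e)"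
    by (simp add: algebra_simps sum_subtractf sum_distrib_left)
  have max_W: "maximal_indep I_out (insert e W) (insert e Q)" if "insert e Q \<in> I_out"
    using that Cons.prems assms(7) by (intro maximal_indep_insert)
  consider (probe) "insert e Q \<in> I_out" "insert e S \<in> I_in" | (outer) "insert e Q \<notin> I_out"
    | (inner) "insert e Q \<in> I_out" "insert e S \<notin> I_in"
    by blast
  then show ?case
  proof cases
    case probe
    let ?T = "g es (insert e Q) (insert e S)" and ?F = "g es (insert e Q) S"
    have "(\<Sum>f\<in>V. p f * y f) \<le>
        k_in * (real (card (insert e S)) + ?T) + k_out * (sum p (insert e Q) + ?T)"
      by (rule Cons.IH[where t = "p e", OF max_W[OF probe(1)]
            maximal_indep_insert[OF assms(6) Cons.prems(2) probe(2)]])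
        (use Cons.prems e t fin in auto)
    moreover have "(\<Sum>f\<in>V. p f * y f) \<le>
        k_in * (real (card S) + ?F) + k_out * (sum p (insert e Q) + ?F)"
      by (rule Cons.IH[where t = "p e", OF max_W[OF probe(1)] Cons.prems(2)])
        (use Cons.prems e t fin in auto)
    \<comment> \<open>On average \<open>card S\<close> grows by \<open>p e\<close>, since it grows
      by one only if \<open>e\<close> is active; \<open>sum p Q\<close> grows by \<open>p e\<close>
      in both branches. Both match the contribution of the root to \<open>g\<close>.\<close>
    ultimately have "p e * (\<Sum>f\<in>V. p f * y f) + (1 - p e) * (\<Sum>f\<in>V. p f * y f) \<le>
        p e * (k_in * (real (card (insert e S)) + ?T) + k_out * (sum p (insert e Q) + ?T)) +
        (1 - p e) * (k_in * (real (card S) + ?F) + k_out * (sum p (insert e Q) + ?F))"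
      using e by (intro add_mono mult_left_mono) auto
    with probe e fin show ?thesis
      by (simp add: g_def algebra_simps)
  next
    case outer
    have "(\<Sum>f\<in>V. p f * y f) \<le> k_in * (real (card S) + g es Q S) + k_out * (sum p Q + g es Q S)"
      by (rule Cons.IH[where t = "p e",
            OF maximal_indep_reject[OF assms(7) Cons.prems(1) outer] Cons.prems(2)])
        (use Cons.prems e t fin in auto)
    with outer show ?thesis
      by (simp add: g_def)
  next
    case inner
    have "(\<Sum>f\<in>V. p f * y f) \<le> k_in * (real (card S) + g es Q S) + k_out * (sum p Q + g es Q S)"
      by (rule Cons.IH[where t = "p e",
            OF Cons.prems(1) maximal_indep_reject[OF assms(6) Cons.prems(2) inner(2)]])
        (use Cons.prems e t fin in auto)
    with inner show ?thesis
      by (simp add: g_def)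
  qed
qed

section \<open>Comparison of greedy with an arbitrary policy\<close>

lemma greedy_in_policies:
  assumes "greedy_order V p es"
  shows "greedy I_in I_out es \<in> policies V I_in I_out"
  using assms unfolding greedy_order_def greedy_def policies_def
  by (auto intro: greedy_feasible)

text \<open>The probing probabilities \<open>y\<close> of \<open>T\<close> satisfy the rank bounds
  \<open>outer\<close> and \<open>inner\<close>, which is all that \<open>greedy_from_bound\<close>
  asks of the competitor.\<close>

lemma probed_weight_le_greedy:
  assumes "probing_instance k_in k_out V p I_in I_out" "greedy_order V p es"
    and "k_in > 0" "k_out > 0" "T \<in> policies V I_in I_out"
  shows "probed_weight p p T \<le> (k_in + k_out) * probed_weight p p (greedy I_in I_out es)"
proof (cases T)
  \<comment> \<open>An empty family satisfies \<open>k_system\<close>. Only a policy that probes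
    something shows that \<open>{}\<close> lies in both families, where the invariant of greedy
    starts; \<open>Stop\<close> has value 0 and is treated separately.\<close>
  case Stop
  have "set_policy (greedy I_in I_out es) \<subseteq> V"
    using greedy_in_policies[OF assms(2), of I_in I_out]
    unfolding policies_def by (auto dest!: set_policy_feasible)
  then have "0 \<le> probed_weight p p (greedy I_in I_out es)"
    using assms(1) unfolding probing_instance_def by (intro probed_weight_nonneg) auto
  with Stop assms show ?thesis
    by simp
next
  case (Probe e T1 T2)
  have inst: "finite V" "\<forall>e\<in>V. 0 \<le> p e \<and> p e \<le> 1" "k_system k_in V I_in" "k_system k_out V I_out"
    using assms(1) by (auto simp: probing_instance_def)
  have feas: "feasible_from V I_in I_out {} {} T"
    using assms(5) by (simp add: policies_def)
  have dc: "downward_closed I_in" "downward_closed I_out"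
    using inst by (auto simp: k_system_def)
  have "{e} \<in> I_in" "{e} \<in> I_out"
    using feas Probe by auto
  then have empty: "{} \<in> I_in" "{} \<in> I_out"
    using dc unfolding downward_closed_def by blast+
  have T_V: "set_policy T \<subseteq> V"
    using set_policy_feasible[OF feas] by simp
  define y where "y e = probed_weight p (indicator {e}) T" for e
  have y_nonneg: "\<forall>e\<in>V. 0 \<le> y e"
    unfolding y_def using T_V inst(2) by (auto intro!: probed_weight_nonneg simp: subset_iff)
  have weight: "probed_weight p h T = (\<Sum>e\<in>V. h e * y e)" for h
    unfolding y_def by (rule probed_weight_sum[OF inst(1) T_V])
  have rank: "\<forall>X\<in>I. real (card (X \<inter> A)) \<le> k * real (card M)"
    if "k_system k V I" "k > 0" "A \<subseteq> V" "maximal_indep I A M" for k I A M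
  proof
    fix X assume "X \<in> I"
    then have "X \<inter> A \<in> I"
      using that unfolding k_system_def downward_closed_def by blast
    with that inst(1) show "real (card (X \<inter> A)) \<le> k * real (card M)"
      by (intro k_system_card_le) auto
  qed
  have outer: "sum y A \<le> k_out * real (card M)"
    if "A \<subseteq> V" "maximal_indep I_out A M" for A M
  proof -
    have "probed_weight p (indicator A) T \<le> k_out * real (card M)"
      using probed_weight_outer_bound[OF feas empty(2) inst(1) _ inst(2)
          rank[OF inst(4) assms(4) that]] by simp
    moreover have "probed_weight p (indicator A) T = sum y A"
      using inst(1) that(1) unfolding weight
      by (intro sum.mono_neutral_cong_right) (auto simp: indicator_def)
    ultimately show ?thesis
      by simp
  qed
  have inner: "(\<Sum>e\<in>A. p e * y e) \<le> k_in * real (card M)"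
    if "A \<subseteq> V" "maximal_indep I_in A M" for A M
  proof -
    have "probed_weight p (\<lambda>e. p e * indicator A e) T \<le> k_in * real (card M)"
      using probed_weight_inner_bound[OF feas empty(1) inst(1) _ _ inst(2)
          rank[OF inst(3) assms(3) that]] by simp
    moreover have "probed_weight p (\<lambda>e. p e * indicator A e) T = (\<Sum>e\<in>A. p e * y e)"
      using inst(1) that(1) unfolding weight
      by (intro sum.mono_neutral_cong_right) (auto simp: indicator_def)
    ultimately show ?thesis
      by simp
  qed
  have max_empty: "maximal_indep I_out {} {}" "maximal_indep I_in {} {}"
    using empty by (auto simp: maximal_indep_def)
  let ?g = "probed_weight p p (greedy I_in I_out es)"
  \<comment> \<open>The initial threshold 1 bounds all probabilities, and the shifted inequality
    holds trivially for empty sets.\<close>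
  have "(\<Sum>e\<in>V. p e * y e) \<le>
      k_in * (real (card ({} :: 'a set)) + ?g) + k_out * (sum p {} + ?g)"
    unfolding greedy_def
    by (rule greedy_from_bound[OF inst(1) assms(3,4) inst(2) y_nonneg dc outer inner max_empty,
          where t = 1])
      (use assms(2) inst(2) in \<open>auto simp: greedy_order_def\<close>)
  then show ?thesis
    unfolding weight by (simp add: algebra_simps)
qed

section \<open>Tightness\<close>

text \<open>
  For \<open>card G = n\<close>, the set \<open>G\<close> blocks every element outside \<open>G \<union> C\<close>, and \<open>C\<close> is unconstrained.
  Sets of size up to \<open>n\<close> that mix \<open>G\<close> with the blocked elements are allowed, which keeps the ratio
  of ranks at most \<open>k\<close> in every subset of \<open>V\<close>, also for non-integral \<open>k\<close>.
\<close>

definition blocking_system :: "nat \<Rightarrow> 'a set \<Rightarrow> 'a set \<Rightarrow> 'a set \<Rightarrow> 'a set set" where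
  "blocking_system n V G C = {X. X \<subseteq> V \<and> (card (X - C) \<le> n \<or> X \<inter> G = {})}"

lemma downward_closed_blocking_system:
  assumes "finite V"
  shows "downward_closed (blocking_system n V G C)"
  unfolding downward_closed_def blocking_system_def
proof (intro ballI allI impI, safe)
  fix X Y assume "Y \<subseteq> X" "X \<subseteq> V" "card (X - C) \<le> n" "\<not> card (Y - C) \<le> n"
  moreover have "card (Y - C) \<le> card (X - C)"
    using \<open>Y \<subseteq> X\<close> \<open>X \<subseteq> V\<close> assms by (meson Diff_mono card_mono finite_Diff finite_subset order_refl)
  ultimately show "y \<in> {}" for y
    by simp
qed auto

text \<open>If \<open>M - C\<close> has fewer than \<open>n\<close> elements, any element of
  \<open>A\<close> can be added, so \<open>M = A\<close>. Otherwise \<open>M\<close> contains the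
  unconstrained part \<open>A \<inter> C\<close>, and \<open>N - C\<close> has at most
  \<open>k * n\<close> elements: it either has at most \<open>n\<close> or avoids \<open>G\<close>
  and lies in \<open>V - G - C\<close>.\<close>

lemma k_system_blocking_system:
  assumes "finite V" "k \<ge> 1" "C \<inter> G = {}" "real (card (V - G - C)) \<le> k * real n"
  shows "k_system k V (blocking_system n V G C)"
  unfolding k_system_def
proof (intro conjI allI impI downward_closed_blocking_system[OF assms(1)])
  let ?I = "blocking_system n V G C"
  fix A M N
  assume "A \<subseteq> V \<and> maximal_indep ?I A M \<and> maximum_indep ?I A N"
  then have A: "A \<subseteq> V" and M: "M \<in> ?I" "M \<subseteq> A" "\<And>X. X \<in> ?I \<Longrightarrow> M \<subseteq> X \<Longrightarrow> X \<subseteq> A \<Longrightarrow> X = M"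
    and N: "N \<in> ?I" "N \<subseteq> A"
    by (auto simp: maximal_indep_def maximum_indep_def)
  have fin: "finite A" "finite M" "finite N"
    using A M(2) N(2) assms(1) by (auto dest: finite_subset)
  have "real (card N) \<le> k * real (card M)"
  proof (cases "n \<le> card (M - C)")
    case True
    have "A \<inter> C \<subseteq> M"
    proof
      fix e assume e: "e \<in> A \<inter> C"
      have "insert e M \<in> ?I"
        using e A M(1) assms(3) by (auto simp: blocking_system_def)
      then show "e \<in> M"
        using M(2) M(3)[of "insert e M"] e by auto
    qed
    then have "card (N \<inter> C) \<le> card (M \<inter> C)"
      using N fin by (intro card_mono) auto
    also have "real \<dots> \<le> k * real (card (M \<inter> C))"
      using assms(2) by (simp add: mult_le_cancel_right1)
    finally have C: "real (card (N \<inter> C)) \<le> k * real (card (M \<inter> C))"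
      by simp
    have "real (card (N - C)) \<le> k * real n"
    proof (cases "card (N - C) \<le> n")
      case True
      then have "real (card (N - C)) \<le> real n"
        by simp
      also have "\<dots> \<le> k * real n"
        using assms(2) by (simp add: mult_le_cancel_right1)
      finally show ?thesis .
    next
      case False
      then have "card (N - C) \<le> card (V - G - C)"
        using N assms(1) by (intro card_mono) (auto simp: blocking_system_def)
      with assms(4) show ?thesis
        by linarith
    qed
    also have "\<dots> \<le> k * real (card (M - C))"
      using True assms(2) by simp
    finally have "real (card (N \<inter> C)) + real (card (N - C)) \<le>
        k * (real (card (M \<inter> C)) + real (card (M - C)))"
      using C by (simp add: distrib_left)
    then show ?thesis
      using card_Int_Diff[of N C] card_Int_Diff[of M C] fin by simp
  next
    case False
    have "A \<subseteq> M"
    proof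
      fix e assume e: "e \<in> A"
      have "insert e M - C \<subseteq> insert e (M - C)"
        by auto
      then have "card (insert e M - C) \<le> card (insert e (M - C))"
        using fin by (intro card_mono) auto
      also have "\<dots> \<le> n"
        using False card_insert_le_m1[of n "M - C" e] by simp
      finally have "insert e M \<in> ?I"
        using e A M(1) by (auto simp: blocking_system_def)
      then show "e \<in> M"
        using M(2) M(3)[of "insert e M"] e by auto
    qed
    then have "real (card N) \<le> real (card M)"
      using N fin by (simp add: card_mono)
    also have "\<dots> \<le> k * real (card M)"
      using assms(2) by (simp add: mult_le_cancel_right1)
    finally show ?thesis .
  qed
  then show "real (card M) \<ge> 1 / k * real (card N)"
    using assms(2) by (simp add: field_simps)
qed (auto simp: blocking_system_def)

text \<open>Every greedy order lists \<open>G\<close> first, and all of \<open>G\<close> is chosen.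
  After that an element outside \<open>B\<close> violates the inner constraint and one outside
  \<open>C\<close> the outer one. Inactive branches have weight \<open>1 - p e = 0\<close>, so one
  set \<open>X\<close> serves as both \<open>Q\<close> and \<open>S\<close>.\<close>

lemma greedy_blocked:
  assumes "finite V" "G \<subseteq> V" "card G = n" "n > 0" "B \<inter> C = {}" "(B \<union> C) \<inter> G = {}"
    and "V = G \<union> B \<union> C" "\<forall>e\<in>G. p e = 1" "\<forall>e\<in>V - G. p e < 1"
    and "X \<subseteq> G" "G - X \<subseteq> set es" "set es \<subseteq> V - X" "distinct es"
    and "sorted_wrt (\<lambda>e f. p e \<ge> p f) es"
  shows "probed_weight p p
    (greedy_from (blocking_system n V G B) (blocking_system n V G C) es X X) = n - real (card X)"
  using assms(10-14)
proof (induction es arbitrary: X)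
  case Nil
  then have "X = G" by auto
  with assms(3) show ?case by simp
next
  case (Cons e es)
  have fin: "finite G" "finite X"
    using assms(1,2) Cons.prems(1) by (auto intro: finite_subset)
  show ?case
  proof (cases "e \<in> G")
    case True
    have "card (insert e X - D) \<le> n" for D
      using True Cons.prems(1) fin assms(3)
      by (metis Diff_subset card_mono insert_subset order_trans)
    then have "insert e X \<in> blocking_system n V G D" for D
      using True Cons.prems(1) assms(2) by (auto simp: blocking_system_def)
    moreover have "probed_weight p p (greedy_from (blocking_system n V G B)
        (blocking_system n V G C) es (insert e X) (insert e X)) = n - real (card (insert e X))"
      by (rule Cons.IH) (use Cons.prems True in auto)
    moreover have "e \<notin> X"
      using Cons.prems by auto
    ultimately show ?thesis
      using True assms(8) fin by simp
  next
    case False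
    \<comment> \<open>A pending element of \<open>G\<close> would come after \<open>e\<close>
      despite its larger probability.\<close>
    have "X = G"
    proof (rule ccontr)
      assume "X \<noteq> G"
      then obtain f where "f \<in> G" "f \<in> set es"
        using Cons.prems False by auto
      then have "p f \<le> p e" "p f = 1" "p e < 1"
        using Cons.prems False assms(8,9) by auto
      then show False
        by simp
    qed
    have blocked: "insert e G \<notin> blocking_system n V G D" if "e \<notin> D" "D \<inter> G = {}" for D
    proof -
      have "insert e G - D = insert e G"
        using that by auto
      moreover have "card (insert e G) = Suc n"
        using False fin assms(3) by simp
      moreover have "G \<noteq> {}"
        using assms(3) assms(4) by auto
      ultimately show ?thesis
        by (auto simp: blocking_system_def)
    qed
    have "e \<notin> B \<or> e \<notin> C"
      using assms(5) by auto
    then have "\<not> (insert e G \<in> blocking_system n V G C \<and> insert e G \<in> blocking_system n V G B)"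
      using blocked[of B] blocked[of C] assms(6) by auto
    moreover have "probed_weight p p (greedy_from (blocking_system n V G B)
        (blocking_system n V G C) es G G) = n - real (card G)"
      by (rule Cons.IH) (use Cons.prems \<open>X = G\<close> in auto)
    ultimately show ?thesis
      using \<open>X = G\<close> by auto
  qed
qed

section \<open>The competing non-adaptive policy and the tight instance\<close>

definition probe_all :: "'a list \<Rightarrow> 'a policy" where
  "probe_all es = foldr (\<lambda>e T. Probe e T T) es Stop"

text \<open>The state together with the whole list is independent in both families, so by downward
  closure no outcome can make a later probe illegal.\<close>

lemma probe_all_feasible:
  assumes "downward_closed I_in" "downward_closed I_out" "distinct es" "set es \<subseteq> V - Q"
    and "Q \<union> set es \<in> I_out" "Q \<union> set es \<in> I_in" "S \<subseteq> Q"
  shows "feasible_from V I_in I_out Q S (probe_all es)"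
  using assms(3-7)
proof (induction es arbitrary: Q S)
  case Nil
  then show ?case by (simp add: probe_all_def)
next
  case (Cons e es)
  have "insert e Q \<subseteq> Q \<union> set (e # es)" "insert e S \<subseteq> Q \<union> set (e # es)"
    using Cons.prems by auto
  then have "insert e Q \<in> I_out" "insert e S \<in> I_in"
    using Cons.prems assms(1,2) unfolding downward_closed_def by blast+
  moreover have "feasible_from V I_in I_out (insert e Q) S' (probe_all es)"
    if "S' \<subseteq> insert e Q" for S'
    using Cons.prems that by (intro Cons.IH) auto
  moreover have "insert e S \<subseteq> insert e Q" "S \<subseteq> insert e Q"
    using Cons.prems by auto
  ultimately show ?case
    using Cons.prems by (simp add: probe_all_def)
qed

lemma probed_weight_probe_all: "probed_weight p h (probe_all es) = sum_list (map h es)"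
  by (induction es) (simp_all add: probe_all_def algebra_simps)

text \<open>Greedy obtains \<open>n\<close>, while probing \<open>B \<union> C\<close> obtains
  \<open>q * (a + b)\<close>, where \<open>a + b\<close> is \<open>K * n\<close> up to rounding. The
  ratio approaches \<open>1 / K\<close> as \<open>q\<close> tends to 1 and \<open>n\<close>
  grows.\<close>

lemma tight_instance:
  fixes k_in k_out c :: real
  assumes "k_in \<ge> 1" "k_out \<ge> 1" "c > 1 / (k_in + k_out)"
  shows "\<exists>(V :: nat set) p I_in I_out. probing_instance k_in k_out V p I_in I_out \<and>
    (\<forall>es. greedy_order V p es \<longrightarrow>
      expected_chosen V p (greedy I_in I_out es) < c * opt_value V p I_in I_out)"
proof -
  define K where "K = k_in + k_out"
  have "K > 0" "c > 1 / K"
    using assms by (simp_all add: K_def)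
  then have "c * K > 1"
    by (simp add: field_simps)
  have "c > 0"
    using \<open>K > 0\<close> \<open>c > 1 / K\<close> less_trans[of 0 "1 / K" c] by simp
  \<comment> \<open>\<open>q < 1\<close> forces \<open>G\<close> to the front of every greedy order,
    whatever the tie-breaking; the lower bound on \<open>q\<close> keeps \<open>c * q * K\<close>
    above 1.\<close>
  from \<open>c * K > 1\<close> obtain q where q: "1 / (c * K) < q" "q < 1"
    using dense[of "1 / (c * K)" 1] by auto
  moreover have "0 < 1 / (c * K)"
    using \<open>K > 0\<close> \<open>c > 0\<close> by simp
  ultimately have "0 < q" "c * q * K > 1"
    using \<open>K > 0\<close> \<open>c > 0\<close> by (linarith, simp add: field_simps)
  \<comment> \<open>The slack \<open>2 * c * q\<close> pays for the two roundings in
    \<open>a\<close> and \<open>b\<close>, each losing less than 1.\<close>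
  then obtain n :: nat where n: "2 * c * q < real n * (c * q * K - 1)"
    using reals_Archimedean3[of "c * q * K - 1"] by auto
  have "n > 0"
    using n \<open>c > 0\<close> \<open>0 < q\<close> by (cases n) (auto simp: mult_less_0_iff)
  define b where "b = nat \<lfloor>k_out * real n\<rfloor>"
  define a where "a = nat \<lfloor>k_in * real n\<rfloor>"
  have ba: "real b \<le> k_out * real n" "k_out * real n < real b + 1"
    "real a \<le> k_in * real n" "k_in * real n < real a + 1"
    using assms(1,2) unfolding a_def b_def by auto
  define G where "G = {..<n}"
  define B where "B = {n..<n + b}"
  define C where "C = {n + b..<n + b + a}"
  define V where "V = G \<union> B \<union> C"
  define p where "p e = (if e \<in> G then 1 else q)" for e
  \<comment> \<open>The inner constraint leaves \<open>B\<close> free and blocks the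
    \<open>a\<close> elements of \<open>C\<close>; the outer one leaves \<open>C\<close> free and
    blocks the \<open>b\<close> elements of \<open>B\<close>.\<close>
  define I_in where "I_in = blocking_system n V G B"
  define I_out where "I_out = blocking_system n V G C"
  have fin: "finite V"
    by (simp add: V_def G_def B_def C_def)
  have disj: "B \<inter> C = {}" "(B \<union> C) \<inter> G = {}"
    by (auto simp: G_def B_def C_def)
  have prob: "\<forall>e\<in>V. 0 \<le> p e \<and> p e \<le> 1"
    using \<open>0 < q\<close> \<open>q < 1\<close> by (auto simp: p_def)
  have "V - G - B = C" "V - G - C = B"
    using disj by (auto simp: V_def)
  then have "k_system k_in V I_in" "k_system k_out V I_out"
    unfolding I_in_def I_out_def using fin assms(1,2) disj ba
    by (auto intro!: k_system_blocking_system simp: B_def C_def)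
  then have inst: "probing_instance k_in k_out V p I_in I_out"
    using fin prob by (simp add: probing_instance_def)
  let ?T = "probe_all [n..<n + b + a]"
  have BC: "set [n..<n + b + a] = B \<union> C"
    by (auto simp: B_def C_def)
  \<comment> \<open>Independent despite its size, because it avoids \<open>G\<close>.\<close>
  have "B \<union> C \<in> I_in" "B \<union> C \<in> I_out"
    using disj by (auto simp: I_in_def I_out_def blocking_system_def V_def)
  then have T: "?T \<in> policies V I_in I_out"
    unfolding policies_def I_in_def I_out_def mem_Collect_eq
    by (intro probe_all_feasible downward_closed_blocking_system fin)
      (auto simp del: set_upt simp: BC V_def)
  have map_p: "map p [n..<n + b + a] = map (\<lambda>_. q) [n..<n + b + a]"
    by (simp add: p_def G_def)
  have "probed_weight p p ?T = q * real (a + b)"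
    unfolding probed_weight_probe_all map_p by (simp add: sum_list_triv algebra_simps)
  with T have opt: "q * real (a + b) \<le> opt_value V p I_in I_out"
    unfolding opt_value_def using finite_policies[OF fin] expected_chosen_eq[OF T fin prob]
    by (intro Max_ge) (auto simp: rev_image_eqI)
  have "real n < c * q * (real n * K - 2)"
    using n by (simp add: algebra_simps)
  also have "\<dots> \<le> c * q * real (a + b)"
    using ba \<open>c > 0\<close> \<open>0 < q\<close> by (intro mult_left_mono) (auto simp: K_def algebra_simps)
  also have "\<dots> \<le> c * opt_value V p I_in I_out"
    using opt \<open>c > 0\<close> by (simp add: mult.assoc)
  finally have n_less: "real n < c * opt_value V p I_in I_out" .
  have "expected_chosen V p (greedy I_in I_out es) = n" if es: "greedy_order V p es" for es
  proof -
    have "expected_chosen V p (greedy I_in I_out es) = probed_weight p p (greedy I_in I_out es)"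
      by (intro expected_chosen_eq[OF greedy_in_policies[OF es] fin prob])
    also have "\<dots> = n - real (card ({} :: nat set))"
      unfolding greedy_def I_in_def I_out_def
      by (rule greedy_blocked[OF fin _ _ \<open>n > 0\<close> disj V_def])
        (use es \<open>q < 1\<close> in \<open>auto simp: greedy_order_def p_def G_def V_def\<close>)
    finally show ?thesis
      by simp
  qed
  with inst n_less show ?thesis
    by (intro exI[of _ V] exI[of _ p] exI[of _ I_in] exI[of _ I_out]) simp
qed

theorem theorem1:
  fixes k_in k_out :: real
  assumes "k_in \<ge> 1" and "k_out \<ge> 1"
  shows "(\<forall>(V :: 'a set) p I_in I_out es.
            probing_instance k_in k_out V p I_in I_out \<and> greedy_order V p es \<longrightarrow>
            expected_chosen V p (greedy I_in I_out es)
              \<ge> 1 / (k_in + k_out) * opt_value V p I_in I_out)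
       \<and> (\<forall>c > 1 / (k_in + k_out). \<exists>(V :: nat set) p I_in I_out.
            probing_instance k_in k_out V p I_in I_out \<and>
            (\<forall>es. greedy_order V p es \<longrightarrow>
              expected_chosen V p (greedy I_in I_out es) < c * opt_value V p I_in I_out))"
proof (intro conjI allI impI)
  fix V :: "'a set" and p I_in I_out es
  assume *: "probing_instance k_in k_out V p I_in I_out \<and> greedy_order V p es"
  then have inst: "finite V" "\<forall>e\<in>V. 0 \<le> p e \<and> p e \<le> 1"
    by (auto simp: probing_instance_def)
  let ?g = "expected_chosen V p (greedy I_in I_out es)"
  have "expected_chosen V p T \<le> (k_in + k_out) * ?g" if "T \<in> policies V I_in I_out" for T
    using probed_weight_le_greedy[of k_in k_out V p I_in I_out es T] * assms that
      greedy_in_policies[of V p es I_in I_out] by (simp add: expected_chosen_eq inst)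
  then have "opt_value V p I_in I_out \<le> (k_in + k_out) * ?g"
    unfolding opt_value_def using finite_policies[OF inst(1)] policies_nonempty[of V I_in I_out]
    by (subst Max_le_iff) auto
  then show "?g \<ge> 1 / (k_in + k_out) * opt_value V p I_in I_out"
    using assms by (simp add: field_simps)
next
  fix c :: real assume "c > 1 / (k_in + k_out)"
  with assms show "\<exists>(V :: nat set) p I_in I_out. probing_instance k_in k_out V p I_in I_out \<and>
      (\<forall>es. greedy_order V p es \<longrightarrow>
        expected_chosen V p (greedy I_in I_out es) < c * opt_value V p I_in I_out)"
    by (rule tight_instance)
qed

end
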